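(* Let $n\geq 3$ and $m\geq 2$ be integers. Assume that $R(T,2K_{m-1})\leq (n-1)(m-2)+2$ holds for every tree $T$ with $n$ vertices. Let $T_n^{*}$ be a tree with $n$ vertices and let $T_n^{**}$ be obtained by Stretching $T_n^{*}$ at a leaf $a$. If $R(T_n^{*},2K_m)\leq (n-1)(m-1)+2$, then $R(T_n^{**},2K_m)\leq (n-1)(m-1)+2$.
   Context: All graphs are finite, undirected and simple. $K_m$ is the complete graph on $m$ vertices and $2K_m$ is the disjoint union of two copies of $K_m$. For graphs $G,H$, the Ramsey number $R(G,H)$ is the minimum integer $N$ such that any coloring of the edges of $K_N$ in red or blue yields a red copy of $G$ or a blue copy of $H$ (as a not necessarily induced subgraph). A leaf is a vertex of degree one. Stretching a tree $T$ at a leaf $a$: let $T$ be a tree with $n\geq 3$ vertices and let $a$ be a leaf of $T$. Let $T'$ be obtained from $T$ by deleting a leaf $b$ of $T$ with $b\neq a$ and adding a new vertex joined only to $a$. Then $T'$ is said to be obtained by Stretching $T$ at leaf $a$ (any choice of $b$ is allowed). *)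

theory Defs
  imports Main "HOL-Library.Ramsey"
begin

datatype 'a graph = Graph (verts: "'a set") (edges: "'a set set")

text \<open>
  Finite, undirected, simple graphs: \<open>[V]\<^bsup>2\<^esup>\<close> is the set of two-element subsets of \<open>V\<close>, so loops and
  multiple edges are excluded.
\<close>
definition is_graph :: "'a graph \<Rightarrow> bool" where
  "is_graph G \<longleftrightarrow> finite (verts G) \<and> edges G \<subseteq> [verts G]\<^bsup>2\<^esup>"

definition complete_graph :: "nat \<Rightarrow> nat graph" where
  "complete_graph m = Graph {..<m} ([{..<m}]\<^bsup>2\<^esup>)"

definition disjoint_union :: "'a graph \<Rightarrow> 'b graph \<Rightarrow> ('a + 'b) graph" where
  "disjoint_union G H =
     Graph (verts G <+> verts H) (image Inl ` edges G \<union> image Inr ` edges H)"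

definition two_complete_graphs :: "nat \<Rightarrow> (nat + nat) graph" where
  "two_complete_graphs m = disjoint_union (complete_graph m) (complete_graph m)"

definition degree :: "'a graph \<Rightarrow> 'a \<Rightarrow> nat" where
  "degree G v = card {e \<in> edges G. v \<in> e}"

definition is_leaf :: "'a graph \<Rightarrow> 'a \<Rightarrow> bool" where
  "is_leaf G v \<longleftrightarrow> v \<in> verts G \<and> degree G v = 1"

definition is_walk :: "'a graph \<Rightarrow> 'a list \<Rightarrow> bool" where
  "is_walk G p \<longleftrightarrow> p \<noteq> [] \<and> set p \<subseteq> verts G \<and>
     (\<forall>i. Suc i < length p \<longrightarrow> {p ! i, p ! Suc i} \<in> edges G)"

definition is_connected :: "'a graph \<Rightarrow> bool" where
  "is_connected G \<longleftrightarrow> verts G \<noteq> {} \<and>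
     (\<forall>u\<in>verts G. \<forall>v\<in>verts G. \<exists>p. is_walk G p \<and> hd p = u \<and> last p = v)"

text \<open>A cycle is given by its distinct vertices in order, without repeating the first one.\<close>
definition is_cycle :: "'a graph \<Rightarrow> 'a list \<Rightarrow> bool" where
  "is_cycle G p \<longleftrightarrow> is_walk G p \<and> distinct p \<and> 3 \<le> length p \<and> {last p, hd p} \<in> edges G"

definition is_tree :: "'a graph \<Rightarrow> bool" where
  "is_tree T \<longleftrightarrow> is_graph T \<and> is_connected T \<and> (\<nexists>p. is_cycle T p)"

text \<open>\<open>G\<close> contains a copy of \<open>H\<close> as a not necessarily induced subgraph.\<close>
definition contains_copy :: "'a graph \<Rightarrow> 'b graph \<Rightarrow> bool" where
  "contains_copy G H \<longleftrightarrow>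
     (\<exists>f. inj_on f (verts H) \<and> f ` verts H \<subseteq> verts G \<and> (\<forall>e\<in>edges H. f ` e \<in> edges G))"

datatype colour = Red | Blue

text \<open>
  Edge colourings are total functions on sets of vertices, but only their values on the edges of
  \<open>G\<close> matter.
\<close>
definition colour_graph :: "'a graph \<Rightarrow> ('a set \<Rightarrow> colour) \<Rightarrow> colour \<Rightarrow> 'a graph" where
  "colour_graph G c k = Graph (verts G) {e \<in> edges G. c e = k}"

definition arrows :: "nat \<Rightarrow> 'a graph \<Rightarrow> 'b graph \<Rightarrow> bool" where
  "arrows N G H \<longleftrightarrow>
     (\<forall>c. contains_copy (colour_graph (complete_graph N) c Red) G \<or>
          contains_copy (colour_graph (complete_graph N) c Blue) H)"

definition ramsey_number :: "'a graph \<Rightarrow> 'b graph \<Rightarrow> nat" where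
  "ramsey_number G H = (LEAST N. arrows N G H)"

text \<open>
  The removed vertex \<open>b\<close> is any leaf other than \<open>a\<close>, and \<open>v\<close> is any vertex not in \<open>T\<close>; different
  choices of \<open>v\<close> give isomorphic graphs.
\<close>
definition stretching :: "'a graph \<Rightarrow> 'a \<Rightarrow> 'a graph \<Rightarrow> bool" where
  "stretching T a T' \<longleftrightarrow> is_tree T \<and> 3 \<le> card (verts T) \<and> is_leaf T a \<and>
     (\<exists>b v. is_leaf T b \<and> b \<noteq> a \<and> v \<notin> verts T \<and>
        T' = Graph (insert v (verts T - {b})) (insert {a, v} {e \<in> edges T. b \<notin> e}))"

lemma contains_copy_of_clique:
  assumes G: "is_graph G" and K: "K \<in> [verts H]\<^bsup>(card (verts G))\<^esup>" and E: "[K]\<^bsup>2\<^esup> \<subseteq> edges H"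
  shows "contains_copy H G"
proof -
  from K have K': "K \<subseteq> verts H" "finite K" "card K = card (verts G)"
    by (auto simp: nsets_def)
  then obtain f where f: "bij_betw f (verts G) K"
    using G finite_same_card_bij unfolding is_graph_def by metis
  have "f ` e \<in> edges H" if "e \<in> edges G" for e
  proof -
    have "e \<in> [verts G]\<^bsup>2\<^esup>"
      using that G unfolding is_graph_def by auto
    then have "f ` e \<in> [K]\<^bsup>2\<^esup>"
      using bij_betw_nsets[OF f, of 2] unfolding bij_betw_def by blast
    then show ?thesis
      using E by blast
  qed
  then show ?thesis
    using f K' unfolding contains_copy_def bij_betw_def by auto
qed

text \<open>
  By the finite Ramsey theorem, the minimum in the definition of the Ramsey number is attained.
\<close>
lemma arrows_ramsey_number:
  assumes "is_graph G" "is_graph H"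
  shows "arrows (ramsey_number G H) G H"
proof -
  let ?a = "card (verts G)" and ?b = "card (verts H)"
  let ?N = "ES 2 ?a ?b"
  have "arrows ?N G H"
    unfolding arrows_def
  proof
    fix c :: "nat set \<Rightarrow> colour"
    let ?f = "\<lambda>e. if c e = Red then 0 else 1 :: nat"
    have "?f \<in> [{..<?N}]\<^bsup>2\<^esup> \<rightarrow> {..<2}"
      by auto
    then obtain i K where i: "i < length [?a, ?b]" and K: "K \<in> [{..<?N}]\<^bsup>([?a, ?b] ! i)\<^esup>"
      and mono: "?f ` [K]\<^bsup>2\<^esup> \<subseteq> {i}"
      using partn_lstE[OF ramsey2_full[of 2 ?a ?b], of ?f 2] by auto
    have KN: "[K]\<^bsup>2\<^esup> \<subseteq> [{..<?N}]\<^bsup>2\<^esup>"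
      using K by (intro nsets_mono) (auto simp: nsets_def)
    consider "i = 0" | "i = 1"
      using i by fastforce
    then show "contains_copy (colour_graph (complete_graph ?N) c Red) G \<or>
          contains_copy (colour_graph (complete_graph ?N) c Blue) H"
    proof cases
      case 1
      then have "\<forall>e\<in>[K]\<^bsup>2\<^esup>. c e = Red"
        using mono by (auto split: if_splits)
      then have "contains_copy (colour_graph (complete_graph ?N) c Red) G"
        using K KN 1
        by (intro contains_copy_of_clique[OF assms(1), of K])
          (auto simp: colour_graph_def complete_graph_def)
      then show ?thesis ..
    next
      case 2
      then have "\<forall>e\<in>[K]\<^bsup>2\<^esup>. c e = Blue"
        using mono by (auto split: if_splits intro: colour.exhaust)
      then have "contains_copy (colour_graph (complete_graph ?N) c Blue) H"
        using K KN 2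
        by (intro contains_copy_of_clique[OF assms(2), of K])
          (auto simp: colour_graph_def complete_graph_def)
      then show ?thesis ..
    qed
  qed
  then show ?thesis
    unfolding ramsey_number_def by (rule LeastI)
qed

end

theory Submission
  imports Defs
begin

text \<open>
  Write \<open>T\<close> for the tree obtained from \<open>T_star\<close> by deleting the leaf \<open>b\<close>; stretching attaches a new
  pendant vertex to the leaf \<open>a\<close> of \<open>T\<close>.  Suppose a colouring of \<open>S\<close>, where
  \<open>card S = (n - 1) * (m - 1) + 2\<close>, has no red copy of the stretched tree and no two disjoint blue
  cliques of size \<open>m\<close>.  The bound for \<open>T_star\<close> gives a red copy of \<open>T_star\<close>, hence of \<open>T\<close>.  Let \<open>W\<close>
  be the set of vertices outside the copy of \<open>T\<close>; it has \<open>(n - 1) * (m - 2) + 2\<close> elements.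

  The engine is that in \<^emph>\<open>every\<close> red copy of \<open>T\<close>, the image of \<open>a\<close> has only blue edges to the outside
  of the copy, for a red edge would complete the stretched tree.  In particular the image \<open>x\<close> of \<open>a\<close>
  is blue to \<open>W\<close>.  By the hypothesis for \<open>m - 1\<close>, \<open>W\<close> contains disjoint blue cliques \<open>A\<close>, \<open>B\<close> of size
  \<open>m - 1\<close>.  Every vertex \<open>z \<noteq> x\<close> of the copy has a red neighbour in \<open>A\<close> and one in \<open>B\<close>: if, say, \<open>z\<close>
  were blue to \<open>B\<close>, then \<open>A\<close> with \<open>x\<close> and \<open>B\<close> with \<open>z\<close> would be two disjoint blue cliques of size \<open>m\<close>.
  So leaves of the copy can be exchanged for vertices of \<open>W\<close>:

  \<^item> the neighbour of \<open>x\<close> in the copy has a red neighbour \<open>w \<in> A\<close>, and \<open>w\<close> can replace \<open>x\<close> in its role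
    as image of \<open>a\<close>; so \<open>w\<close> is blue to \<open>x\<close> and to the rest of \<open>W\<close> as well;
  \<^item> for another leaf \<open>l\<close> of \<open>T\<close>, whose neighbour is not \<open>a\<close>, the image of that neighbour has a red
    neighbour in \<open>B\<close>, which can replace the image \<open>y\<close> of \<open>l\<close>; then \<open>y\<close> lies outside a copy that uses
    \<open>x\<close>, and outside another copy that uses \<open>w\<close>, so \<open>x\<close> and \<open>w\<close> are both blue to \<open>y\<close>.

  Now \<open>x\<close> and \<open>w\<close> are blue to all of \<open>(W - {w}) \<union> {y}\<close>, which is as large as \<open>W\<close>.  The hypothesis for
  \<open>m - 1\<close> gives two disjoint blue cliques of size \<open>m - 1\<close> in there; adding \<open>x\<close> to one and \<open>w\<close> to the
  other is a contradiction.  A suitable \<open>l\<close> exists as soon as \<open>T\<close> has three vertices; if \<open>T\<close> is a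
  single edge, its two ends can be interchanged, which contradicts the red neighbour in \<open>A\<close> at once.

  All this is lemma \<open>pendant_copy_or_two_cliques\<close>.  To use the hypothesis for \<open>m - 1\<close>, the stretched
  graph has to be a tree: \<open>is_tree_delete_leaf\<close> and \<open>is_tree_add_pendant\<close>.
\<close>

section \<open>Trees\<close>

lemma is_leafE:
  assumes "is_graph G" "is_leaf G b"
  obtains c where "b \<in> verts G" "c \<in> verts G" "c \<noteq> b" "{b, c} \<in> edges G"
    "\<And>e. e \<in> edges G \<Longrightarrow> b \<in> e \<Longrightarrow> e = {b, c}"
proof -
  have "card {e \<in> edges G. b \<in> e} = 1" and b: "b \<in> verts G"
    using assms by (auto simp: is_leaf_def degree_def)
  then obtain e where e: "{e \<in> edges G. b \<in> e} = {e}"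
    by (meson card_1_singletonE)
  then have "e \<in> edges G" "b \<in> e"
    by auto
  then have "e \<in> [verts G]\<^bsup>2\<^esup>" "b \<in> e"
    using assms by (auto simp: is_graph_def)
  then obtain c where "c \<in> verts G" "c \<noteq> b" "e = {b, c}"
    by (auto simp: nsets_2_eq insert_commute)
  with b e show ?thesis
    by (intro that[of c]) auto
qed

lemma is_leafI:
  assumes "b \<in> verts G" "{b, c} \<in> edges G" "\<And>e. e \<in> edges G \<Longrightarrow> b \<in> e \<Longrightarrow> e = {b, c}"
  shows "is_leaf G b"
proof -
  have "{e \<in> edges G. b \<in> e} = {{b, c}}"
    using assms(2) by (auto dest: assms(3))
  then show ?thesis
    using assms(1) by (simp add: is_leaf_def degree_def)
qed

definition adj_rel :: "'a graph \<Rightarrow> 'a rel" where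
  "adj_rel G = {(x, y). {x, y} \<in> edges G}"

lemma walk_imp_rtrancl:
  assumes "is_walk G p"
  shows "(hd p, last p) \<in> (adj_rel G)\<^sup>*"
proof -
  have "i < length p \<Longrightarrow> (p ! 0, p ! i) \<in> (adj_rel G)\<^sup>*" for i
  proof (induction i)
    case (Suc i)
    then have "(p ! i, p ! Suc i) \<in> adj_rel G"
      using assms by (auto simp: is_walk_def adj_rel_def)
    with Suc show ?case
      by (meson Suc_lessD rtrancl.rtrancl_into_rtrancl)
  qed auto
  moreover have "p \<noteq> []"
    using assms by (simp add: is_walk_def)
  ultimately show ?thesis
    by (simp add: hd_conv_nth last_conv_nth)
qed

lemma walk_snoc:
  assumes "is_walk G p" "{last p, y} \<in> edges G" "y \<in> verts G"
  shows "is_walk G (p @ [y])"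
  unfolding is_walk_def
proof (intro conjI allI impI)
  fix i assume "Suc i < length (p @ [y])"
  then consider "Suc i < length p" | "i = length p - 1" "Suc i = length p"
    by fastforce
  then show "{(p @ [y]) ! i, (p @ [y]) ! Suc i} \<in> edges G"
  proof cases
    case 1
    then show ?thesis
      using assms(1) by (simp add: is_walk_def nth_append)
  next
    case 2
    then show ?thesis
      using assms by (simp add: is_walk_def nth_append last_conv_nth)
  qed
qed (use assms in \<open>auto simp: is_walk_def\<close>)

lemma rtrancl_imp_walk:
  assumes "is_graph G" "(u, v) \<in> (adj_rel G)\<^sup>*" "u \<in> verts G"
  shows "\<exists>p. is_walk G p \<and> hd p = u \<and> last p = v"
  using assms(2)
proof (induction rule: rtrancl_induct)
  case base
  then show ?case
    using assms by (intro exI[of _ "[u]"]) (auto simp: is_walk_def)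
next
  case (step y z)
  then obtain p where p: "is_walk G p" "hd p = u" "last p = y"
    by auto
  have "{y, z} \<in> edges G"
    using step by (simp add: adj_rel_def)
  moreover from this have "z \<in> verts G"
    using assms by (auto simp: is_graph_def nsets_def)
  ultimately have "is_walk G (p @ [z])"
    using p by (auto intro: walk_snoc)
  moreover have "hd (p @ [z]) = u"
    using p by (simp add: is_walk_def)
  ultimately show ?case
    by (metis last_snoc)
qed

text \<open>Turns connectedness into a closure, so that walks can be rerouted by rule induction.\<close>

lemma is_connected_iff_rtrancl:
  assumes "is_graph G"
  shows "is_connected G \<longleftrightarrow>
    verts G \<noteq> {} \<and> (\<forall>u\<in>verts G. \<forall>v\<in>verts G. (u, v) \<in> (adj_rel G)\<^sup>*)"
proof -
  have "(\<exists>p. is_walk G p \<and> hd p = u \<and> last p = v) \<longleftrightarrow> (u, v) \<in> (adj_rel G)\<^sup>*"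
    if "u \<in> verts G" for u v
    using that rtrancl_imp_walk[OF assms, of u v] by (auto dest: walk_imp_rtrancl)
  then show ?thesis
    by (simp add: is_connected_def)
qed

text \<open>A pendant vertex therefore lies on no cycle, which is why attaching one creates none.\<close>

lemma cycle_two_neighbours:
  assumes "is_cycle G p" "x \<in> set p"
  obtains y z where "y \<noteq> z" "{x, y} \<in> edges G" "{x, z} \<in> edges G"
proof -
  let ?k = "length p"
  have p: "distinct p" "3 \<le> ?k" "{p ! (?k - 1), p ! 0} \<in> edges G"
    and E: "\<And>i. Suc i < ?k \<Longrightarrow> {p ! i, p ! Suc i} \<in> edges G"
    using assms(1) by (auto simp: is_cycle_def is_walk_def hd_conv_nth last_conv_nth)
  obtain i where i: "i < ?k" "x = p ! i"
    using assms(2) by (auto simp: in_set_conv_nth)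
  consider "i = 0" | "i = ?k - 1" "0 < i" | "0 < i" "Suc i < ?k"
    using i by linarith
  then show ?thesis
  proof cases
    case 1
    have "p ! 1 \<noteq> p ! (?k - 1)"
      using p by (subst nth_eq_iff_index_eq) auto
    with 1 show ?thesis
      using that[of "p ! 1" "p ! (?k - 1)"] E[of 0] p i by (auto simp: insert_commute)
  next
    case 2
    then obtain j where j: "i = Suc j"
      using gr0_implies_Suc by blast
    have "p ! j \<noteq> p ! 0"
      using p i 2 j by (subst nth_eq_iff_index_eq) auto
    with 2 j show ?thesis
      using that[of "p ! j" "p ! 0"] E[of j] p i by (auto simp: insert_commute)
  next
    case 3
    have "p ! (i - 1) \<noteq> p ! Suc i"
      using p i 3 by (subst nth_eq_iff_index_eq) auto
    with 3 show ?thesis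
      using that[of "p ! (i - 1)" "p ! Suc i"] E[of "i - 1"] E[of i] i by (auto simp: insert_commute)
  qed
qed

lemma cycle_transfer:
  assumes "is_cycle G p" "set p \<subseteq> verts H" "\<And>e. e \<in> edges G \<Longrightarrow> e \<subseteq> set p \<Longrightarrow> e \<in> edges H"
  shows "is_cycle H p"
proof -
  have "p \<noteq> []"
    using assms(1) by (auto simp: is_cycle_def is_walk_def)
  then have "{last p, hd p} \<subseteq> set p"
    by auto
  moreover have "{p ! i, p ! Suc i} \<subseteq> set p" if "Suc i < length p" for i
    using that by auto
  moreover have "{last p, hd p} \<in> edges G"
    "\<And>i. Suc i < length p \<Longrightarrow> {p ! i, p ! Suc i} \<in> edges G"
    using assms(1) by (auto simp only: is_cycle_def is_walk_def)
  ultimately have "{last p, hd p} \<in> edges H"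
    "\<And>i. Suc i < length p \<Longrightarrow> {p ! i, p ! Suc i} \<in> edges H"
    using assms(3) by simp_all
  then show ?thesis
    using assms(1,2) by (simp add: is_cycle_def is_walk_def)
qed

definition delete_vertex :: "'a graph \<Rightarrow> 'a \<Rightarrow> 'a graph" where
  "delete_vertex G b = Graph (verts G - {b}) {e \<in> edges G. b \<notin> e}"

definition add_pendant :: "'a graph \<Rightarrow> 'a \<Rightarrow> 'a \<Rightarrow> 'a graph" where
  "add_pendant G a v = Graph (insert v (verts G)) (insert {a, v} (edges G))"

lemma is_tree_delete_leaf:
  assumes T: "is_tree T" and b: "is_leaf T b"
  shows "is_tree (delete_vertex T b)"
proof -
  let ?D = "delete_vertex T b"
  have G: "is_graph T" and con: "is_connected T" and acyc: "\<nexists>p. is_cycle T p"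
    using T by (auto simp: is_tree_def)
  obtain c where c: "b \<in> verts T" "c \<in> verts T" "c \<noteq> b" "{b, c} \<in> edges T"
    "\<And>e. e \<in> edges T \<Longrightarrow> b \<in> e \<Longrightarrow> e = {b, c}"
    using is_leafE[OF G b] by metis
  have GD: "is_graph ?D"
    using G by (auto simp: is_graph_def delete_vertex_def nsets_def)
  \<comment> \<open>A walk that visits the leaf \<open>b\<close> must return to its neighbour \<open>c\<close>, so while at \<open>b\<close> the walk in the
      smaller graph waits at \<open>c\<close>.\<close>
  have reach: "(v \<noteq> b \<longrightarrow> (u, v) \<in> (adj_rel ?D)\<^sup>*) \<and> (v = b \<longrightarrow> (u, c) \<in> (adj_rel ?D)\<^sup>*)"
    if "(u, v) \<in> (adj_rel T)\<^sup>*" "u \<noteq> b" for u v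
    using that(1)
  proof (induction rule: rtrancl_induct)
    case base
    then show ?case using that(2) by auto
  next
    case (step y z)
    have yz: "{y, z} \<in> edges T"
      using step(2) by (simp add: adj_rel_def)
    consider "y = b" | "y \<noteq> b" "z = b" | "y \<noteq> b" "z \<noteq> b"
      by blast
    then show ?case
    proof cases
      case 1
      then have "z = c"
        using c(3) c(5)[OF yz] by (auto simp: doubleton_eq_iff)
      then show ?thesis
        using step.IH 1 c(3) by auto
    next
      case 2
      then have "y = c"
        using c(3) c(5)[OF yz] by (auto simp: doubleton_eq_iff)
      then show ?thesis
        using step.IH 2 by auto
    next
      case 3
      then have "(y, z) \<in> adj_rel ?D"
        using yz by (auto simp: adj_rel_def delete_vertex_def)
      then show ?thesis
        using step.IH 3 by (meson rtrancl.rtrancl_into_rtrancl)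
    qed
  qed
  have "is_connected ?D"
    unfolding is_connected_iff_rtrancl[OF GD]
  proof (intro conjI ballI)
    show "verts ?D \<noteq> {}"
      using c by (auto simp: delete_vertex_def)
    show "(u, v) \<in> (adj_rel ?D)\<^sup>*" if "u \<in> verts ?D" "v \<in> verts ?D" for u v
      using that con reach[of u v] unfolding is_connected_iff_rtrancl[OF G]
      by (auto simp: delete_vertex_def)
  qed
  moreover have False if "is_cycle ?D p" for p
  proof -
    have "set p \<subseteq> verts T"
      using that by (auto simp: is_cycle_def is_walk_def delete_vertex_def)
    then have "is_cycle T p"
      by (rule cycle_transfer[OF that]) (auto simp: delete_vertex_def)
    then show False using acyc by blast
  qed
  ultimately show ?thesis
    using GD by (auto simp: is_tree_def)
qed

lemma is_tree_add_pendant: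
  assumes T: "is_tree T" and a: "a \<in> verts T" and v: "v \<notin> verts T"
  shows "is_tree (add_pendant T a v)"
proof -
  let ?P = "add_pendant T a v"
  have G: "is_graph T" and con: "is_connected T" and acyc: "\<nexists>p. is_cycle T p"
    using T by (auto simp: is_tree_def)
  have v_edge: "v \<notin> e" if "e \<in> edges T" for e
    using that G v by (auto simp: is_graph_def nsets_def)
  have av: "a \<noteq> v"
    using a v by auto
  have GP: "is_graph ?P"
    using G a av by (auto simp: is_graph_def add_pendant_def nsets_def)
  have "(adj_rel T)\<^sup>* \<subseteq> (adj_rel ?P)\<^sup>*"
    by (rule rtrancl_mono) (auto simp: adj_rel_def add_pendant_def)
  then have reach: "(x, y) \<in> (adj_rel ?P)\<^sup>*" if "x \<in> verts T" "y \<in> verts T" for x y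
    using that con unfolding is_connected_iff_rtrancl[OF G] by auto
  have "(a, v) \<in> adj_rel ?P" "(v, a) \<in> adj_rel ?P"
    by (auto simp: adj_rel_def add_pendant_def insert_commute)
  then have "(x, y) \<in> (adj_rel ?P)\<^sup>*" if "x \<in> verts ?P" "y \<in> verts ?P" for x y
    using that reach a unfolding add_pendant_def
    by (metis converse_rtrancl_into_rtrancl graph.sel(1) insertE rtrancl.rtrancl_into_rtrancl
        rtrancl.rtrancl_refl)
  then have "is_connected ?P"
    unfolding is_connected_iff_rtrancl[OF GP] by (auto simp: add_pendant_def)
  moreover have False if p: "is_cycle ?P p" for p
  proof (cases "v \<in> set p")
    case True
    obtain y z where yz: "y \<noteq> z" "{v, y} \<in> edges ?P" "{v, z} \<in> edges ?P"
      using cycle_two_neighbours[OF p True] by metis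
    then show False
      using v_edge av by (auto simp: add_pendant_def doubleton_eq_iff)
  next
    case False
    have "set p \<subseteq> verts T"
      using p False by (auto simp: is_cycle_def is_walk_def add_pendant_def)
    then have "is_cycle T p"
      by (rule cycle_transfer[OF p]) (use False in \<open>auto simp: add_pendant_def\<close>)
    then show False using acyc by blast
  qed
  ultimately show ?thesis
    using GP by (auto simp: is_tree_def)
qed

text \<open>Without a third vertex next to \<open>p\<close>, the set \<open>{a, p}\<close> would be a whole connected component.\<close>

lemma connected_leaf_neighbour_branches:
  assumes G: "is_graph T" and con: "is_connected T" and card: "3 \<le> card (verts T)"
    and a: "a \<in> verts T" "p \<in> verts T" and p: "p \<noteq> a"
    and uniq: "\<And>e. e \<in> edges T \<Longrightarrow> a \<in> e \<Longrightarrow> e = {a, p}"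
  shows "\<exists>r. r \<notin> {a, p} \<and> {p, r} \<in> edges T"
proof -
  have "\<not> verts T \<subseteq> {a, p}"
  proof
    assume "verts T \<subseteq> {a, p}"
    then have "card (verts T) \<le> card {a, p}"
      by (intro card_mono) auto
    then show False
      using card p by simp
  qed
  then obtain s where s: "s \<in> verts T" "s \<notin> {a, p}"
    by blast
  show ?thesis
  proof (rule ccontr)
    assume no: "\<not> ?thesis"
    have "(a, s) \<in> (adj_rel T)\<^sup>*"
      using con s a unfolding is_connected_iff_rtrancl[OF G] by auto
    then have "s \<in> {a, p}"
    proof (induction rule: rtrancl_induct)
      case (step y z)
      then have "{y, z} \<in> edges T" "y \<in> {a, p}"
        by (auto simp: adj_rel_def)
      then show ?case
        using no uniq[of "{y, z}"] p by (auto simp: doubleton_eq_iff)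
    qed auto
    with s show False by blast
  qed
qed

text \<open>
  A longest path that starts at \<open>a\<close> ends in such a vertex \<open>l\<close>: a neighbour of its end off the path would
  make it longer, and a neighbour on the path other than the last but one would close a cycle.  The
  path has at least three vertices, so the last but one is not \<open>a\<close>.
\<close>

lemma tree_second_leaf:
  assumes T: "is_tree T" and a: "is_leaf T a" and card: "3 \<le> card (verts T)"
  obtains l q where "l \<in> verts T" "q \<in> verts T" "l \<noteq> a" "q \<noteq> a" "q \<noteq> l" "{l, q} \<in> edges T"
    "\<And>e. e \<in> edges T \<Longrightarrow> l \<in> e \<Longrightarrow> e = {l, q}"
proof -
  have G: "is_graph T" and con: "is_connected T" and acyc: "\<nexists>p. is_cycle T p"
    using T by (auto simp: is_tree_def)
  have fin: "finite (verts T)"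
    using G by (simp add: is_graph_def)
  obtain p where p: "a \<in> verts T" "p \<in> verts T" "p \<noteq> a" "{a, p} \<in> edges T"
    "\<And>e. e \<in> edges T \<Longrightarrow> a \<in> e \<Longrightarrow> e = {a, p}"
    using is_leafE[OF G a] by metis
  have "\<exists>r. r \<notin> {a, p} \<and> {p, r} \<in> edges T"
    using connected_leaf_neighbour_branches[OF G con card p(1,2) p(3,5)] by blast
  then obtain r where r: "r \<notin> {a, p}" "{p, r} \<in> edges T"
    by blast
  have rV: "r \<in> verts T"
    using G r(2) by (auto simp: is_graph_def nsets_def)
  define P where "P ps \<longleftrightarrow> is_walk T ps \<and> distinct ps \<and> hd ps = a" for ps
  have "is_walk T [a]"
    using p(1) by (simp add: is_walk_def)
  then have "is_walk T [a, p]"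
    using walk_snoc[of T "[a]" p] p(2,4) by simp
  then have "is_walk T [a, p, r]"
    using walk_snoc[of T "[a, p]" r] r(2) rV by simp
  then have start: "P [a, p, r]"
    using p(3) r(1) by (auto simp: P_def)
  have "length ps < Suc (card (verts T))" if "P ps" for ps
    using that fin card_mono[of "verts T" "set ps"] distinct_card[of ps]
    by (auto simp: P_def is_walk_def)
  then obtain ps where ps: "P ps" and max: "\<And>qs. P qs \<Longrightarrow> length qs \<le> length ps"
    using ex_has_greatest_nat[of P "[a, p, r]" length "Suc (card (verts T))"] start by blast
  let ?k = "length ps"
  have k: "3 \<le> ?k"
    using max[OF start] by simp
  have walk: "is_walk T ps" and dist: "distinct ps" and hd: "ps ! 0 = a"
    using ps k by (auto simp: P_def is_walk_def hd_conv_nth)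
  have sub: "set ps \<subseteq> verts T"
    and E: "\<And>i. Suc i < ?k \<Longrightarrow> {ps ! i, ps ! Suc i} \<in> edges T"
    using walk by (auto simp: is_walk_def)
  let ?l = "ps ! (?k - 1)" and ?q = "ps ! (?k - 2)"
  have last: "last ps = ?l"
    using k by (subst last_conv_nth) auto
  have lq: "{?l, ?q} \<in> edges T"
    using E[of "?k - 2"] k by (simp add: insert_commute numeral_2_eq_2 Suc_diff_Suc)
  have ne: "?l \<noteq> a" "?q \<noteq> a" "?q \<noteq> ?l"
    unfolding hd[symmetric]
    using nth_eq_iff_index_eq[OF dist, of "?k - 1" 0] nth_eq_iff_index_eq[OF dist, of "?k - 2" 0]
      nth_eq_iff_index_eq[OF dist, of "?k - 2" "?k - 1"] k by linarith+
  have uniq: "e = {?l, ?q}" if e: "e \<in> edges T" "?l \<in> e" for e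
  proof -
    have "e \<in> [verts T]\<^bsup>2\<^esup>"
      using e G by (auto simp: is_graph_def)
    then obtain y where y: "y \<in> verts T" "y \<noteq> ?l" "e = {?l, y}"
      using e(2) by (auto simp: nsets_2_eq insert_commute)
    have "y \<in> set ps"
    proof (rule ccontr)
      assume "y \<notin> set ps"
      then have "P (ps @ [y])"
        using ps y e(1) last k by (auto simp: P_def hd_append intro!: walk_snoc)
      then show False
        using max[of "ps @ [y]"] by simp
    qed
    then obtain i where i: "i < ?k" "y = ps ! i"
      by (auto simp: in_set_conv_nth)
    have "i = ?k - 2"
    proof (rule ccontr)
      assume "i \<noteq> ?k - 2"
      moreover have "i \<noteq> ?k - 1"
        using i y(2) by auto
      ultimately have i3: "i + 3 \<le> ?k"
        using i by linarith
      have "is_walk T (drop i ps)"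
        using i sub E by (auto simp: is_walk_def dest: in_set_dropD)
      moreover have "{last (drop i ps), hd (drop i ps)} \<in> edges T"
        using i last y e(1) by (simp add: hd_drop_conv_nth)
      ultimately have "is_cycle T (drop i ps)"
        using dist i3 by (auto simp: is_cycle_def)
      then show False using acyc by blast
    qed
    then show ?thesis
      using y i by simp
  qed
  have "?l \<in> verts T" "?q \<in> verts T"
    using lq G by (auto simp: is_graph_def)
  then show ?thesis
    using ne lq uniq by (rule that)
qed

section \<open>Copies in coloured complete graphs\<close>

definition mono_graph :: "'b set \<Rightarrow> ('b set \<Rightarrow> colour) \<Rightarrow> colour \<Rightarrow> 'b graph" where
  "mono_graph S c k = Graph S {e \<in> [S]\<^bsup>2\<^esup>. c e = k}"

lemma colour_graph_complete_graph:
  "colour_graph (complete_graph N) c k = mono_graph {..<N} c k"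
  by (simp add: colour_graph_def complete_graph_def mono_graph_def)

definition embeds :: "('a \<Rightarrow> 'b) \<Rightarrow> 'a graph \<Rightarrow> 'b graph \<Rightarrow> bool" where
  "embeds f H G \<longleftrightarrow>
     inj_on f (verts H) \<and> f ` verts H \<subseteq> verts G \<and> (\<forall>e\<in>edges H. f ` e \<in> edges G)"

lemma contains_copy_iff_embeds: "contains_copy G H \<longleftrightarrow> (\<exists>f. embeds f H G)"
  by (simp add: contains_copy_def embeds_def)

lemma embeds_mono: "embeds f H G \<Longrightarrow> verts G \<subseteq> verts G' \<Longrightarrow> edges G \<subseteq> edges G' \<Longrightarrow> embeds f H G'"
  by (auto simp: embeds_def)

lemma mono_graph_copy_subset:
  assumes "contains_copy (mono_graph S c k) H" "S \<subseteq> S'"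
  shows "contains_copy (mono_graph S' c k) H"
proof -
  have "[S]\<^bsup>2\<^esup> \<subseteq> [S']\<^bsup>2\<^esup>"
    by (rule nsets_mono) (rule assms(2))
  then have "verts (mono_graph S c k) \<subseteq> verts (mono_graph S' c k)"
    "edges (mono_graph S c k) \<subseteq> edges (mono_graph S' c k)"
    using assms(2) by (auto simp: mono_graph_def)
  then show ?thesis
    using assms(1) embeds_mono unfolding contains_copy_iff_embeds by blast
qed

text \<open>
  The vertex \<open>l\<close> may be new or may already be a vertex of \<open>H\<close>.  In the first case the lemma extends a
  copy by a pendant vertex; in the second it moves a leaf \<open>l\<close> with neighbour \<open>q\<close> to another place.
\<close>

lemma embeds_fun_upd:
  assumes f: "embeds f H G" and q: "q \<in> verts H" "q \<noteq> l"
    and w: "w \<in> verts G" "w \<notin> f ` verts H" "{f q, w} \<in> edges G"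
    and V: "verts H' \<subseteq> insert l (verts H)"
    and E: "edges H' \<subseteq> insert {l, q} {e \<in> edges H. l \<notin> e}"
  shows "embeds (f(l := w)) H' G"
  unfolding embeds_def
proof (intro conjI ballI)
  have inj: "inj_on f (verts H)"
    using f by (simp add: embeds_def)
  have "inj_on (f(l := w)) (insert l (verts H))"
    using inj w(2) unfolding inj_on_def by auto
  then show "inj_on (f(l := w)) (verts H')"
    using V by (rule inj_on_subset)
  show "(f(l := w)) ` verts H' \<subseteq> verts G"
    using f w(1) V by (auto simp: embeds_def)
  show "(f(l := w)) ` e \<in> edges G" if "e \<in> edges H'" for e
  proof (cases "e = {l, q}")
    case True
    then show ?thesis
      using w(3) q(2) by (simp add: insert_commute)
  next
    case False
    then have "e \<in> edges H" "l \<notin> e"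
      using that E by auto
    moreover from this have "(f(l := w)) ` e = f ` e"
      by (intro image_cong) auto
    ultimately show ?thesis
      using f by (simp add: embeds_def)
  qed
qed

text \<open>
  Pulling a colouring back along an injection makes the arrow relation available inside any
  sufficiently large vertex set, such as the complement of a copy.
\<close>

lemma arrows_finite_set:
  fixes S :: "'b set"
  assumes arr: "arrows M G H" and S: "finite S" "M \<le> card S"
  shows "contains_copy (mono_graph S c Red) G \<or> contains_copy (mono_graph S c Blue) H"
proof -
  obtain g :: "nat \<Rightarrow> 'b" where g: "inj_on g {..<M}" "g ` {..<M} \<subseteq> S"
    using card_le_inj[of "{..<M}" S] S by auto
  have copy: "contains_copy (mono_graph S c k) F"
    if F: "contains_copy (mono_graph {..<M} (\<lambda>e. c (g ` e)) k) F" for k and F :: "'d graph"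
  proof -
    obtain f where f: "embeds f F (mono_graph {..<M} (\<lambda>e. c (g ` e)) k)"
      using F by (auto simp: contains_copy_iff_embeds)
    then have sub: "f ` verts F \<subseteq> {..<M}"
      by (simp add: embeds_def mono_graph_def)
    have "inj_on (g \<circ> f) (verts F)"
      using f g(1) sub by (auto simp: embeds_def intro: comp_inj_on inj_on_subset)
    moreover have "(g \<circ> f) ` verts F \<subseteq> verts (mono_graph S c k)"
      using sub g(2) by (auto simp: mono_graph_def)
    moreover have "(g \<circ> f) ` e \<in> edges (mono_graph S c k)" if e: "e \<in> edges F" for e
    proof -
      have fe: "f ` e \<in> [{..<M}]\<^bsup>2\<^esup>" "c (g ` f ` e) = k"
        using f e by (auto simp: embeds_def mono_graph_def)
      then have "g ` f ` e \<in> [S]\<^bsup>2\<^esup>"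
        using g nsets_image_funcset[of g "{..<M}" S 2] by blast
      then show ?thesis
        using fe by (simp add: mono_graph_def image_comp)
    qed
    ultimately have "embeds (g \<circ> f) F (mono_graph S c k)"
      unfolding embeds_def by blast
    then show ?thesis
      by (auto simp: contains_copy_iff_embeds)
  qed
  have "contains_copy (mono_graph {..<M} (\<lambda>e. c (g ` e)) Red) G \<or>
    contains_copy (mono_graph {..<M} (\<lambda>e. c (g ` e)) Blue) H"
    using arr unfolding arrows_def colour_graph_complete_graph by (rule spec)
  then show ?thesis
    by (rule disj_forward) (erule copy)+
qed

lemma arrows_ge:
  assumes "arrows M G H" "M \<le> N"
  shows "arrows N G H"
  unfolding arrows_def colour_graph_complete_graph
  by (intro allI arrows_finite_set[OF assms(1)]) (use assms(2) in simp_all)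

lemma arrows_iff_ramsey_number_le:
  assumes "is_graph G" "is_graph H"
  shows "arrows N G H \<longleftrightarrow> ramsey_number G H \<le> N"
proof
  show "ramsey_number G H \<le> N" if "arrows N G H"
    unfolding ramsey_number_def using that by (rule Least_le)
  show "arrows N G H" if "ramsey_number G H \<le> N"
    using arrows_ramsey_number[OF assms] that by (rule arrows_ge)
qed

lemma two_complete_graphs_simps:
  "verts (two_complete_graphs m) = {..<m} <+> {..<m}"
  "edges (two_complete_graphs m) = image Inl ` [{..<m}]\<^bsup>2\<^esup> \<union> image Inr ` [{..<m}]\<^bsup>2\<^esup>"
  by (simp_all add: two_complete_graphs_def disjoint_union_def complete_graph_def)

lemma is_graph_two_complete_graphs: "is_graph (two_complete_graphs m)"
proof -
  have "finite ({..<m} <+> {..<m})"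
    by simp
  moreover have "image Inl ` [{..<m}]\<^bsup>2\<^esup> \<subseteq> [{..<m} <+> {..<m}]\<^bsup>2\<^esup>"
    by (auto simp: nsets_def card_image)
  moreover have "image Inr ` [{..<m}]\<^bsup>2\<^esup> \<subseteq> [{..<m} <+> {..<m}]\<^bsup>2\<^esup>"
    by (auto simp: nsets_def card_image)
  ultimately show ?thesis
    by (simp add: is_graph_def two_complete_graphs_simps)
qed

definition is_clique :: "'b set \<Rightarrow> ('b set \<Rightarrow> colour) \<Rightarrow> colour \<Rightarrow> nat \<Rightarrow> 'b set \<Rightarrow> bool" where
  "is_clique S c k m A \<longleftrightarrow> A \<subseteq> S \<and> finite A \<and> card A = m \<and>
     (\<forall>x\<in>A. \<forall>y\<in>A. x \<noteq> y \<longrightarrow> c {x, y} = k)"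

lemma is_clique_insert:
  assumes "is_clique S c k m A" "x \<in> S" "x \<notin> A" "\<And>y. y \<in> A \<Longrightarrow> c {x, y} = k"
  shows "is_clique S c k (Suc m) (insert x A)"
  using assms by (auto simp: is_clique_def insert_commute)

lemma copy_two_complete_graphsI:
  assumes A: "is_clique S c k m A" and B: "is_clique S c k m B" and AB: "A \<inter> B = {}"
  shows "contains_copy (mono_graph S c k) (two_complete_graphs m)"
proof -
  obtain g where g: "bij_betw g {..<m} A"
    using A finite_same_card_bij[of "{..<m}" A] by (auto simp: is_clique_def)
  obtain h where h: "bij_betw h {..<m} B"
    using B finite_same_card_bij[of "{..<m}" B] by (auto simp: is_clique_def)
  let ?f = "case_sum g h"
  have *: "F ` e \<in> edges (mono_graph S c k)"
    if F: "bij_betw F {..<m} C" and C: "is_clique S c k m C" and e: "e \<in> [{..<m}]\<^bsup>2\<^esup>" for F C e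
  proof -
    obtain i j where ij: "e = {i, j}" "i < m" "j < m" "i \<noteq> j"
      using e by (auto simp: nsets_2_eq)
    then have "F i \<in> C" "F j \<in> C" "F i \<noteq> F j"
      using F by (auto simp: bij_betw_def inj_on_def)
    then show ?thesis
      using C ij by (auto simp: mono_graph_def is_clique_def)
  qed
  have "embeds ?f (two_complete_graphs m) (mono_graph S c k)"
    unfolding embeds_def two_complete_graphs_simps
  proof (intro conjI ballI)
    show "inj_on ?f ({..<m} <+> {..<m})"
    proof -
      have "g i \<noteq> h j" if "i < m" "j < m" for i j
        using that g h AB by (auto simp: bij_betw_def)
      then show ?thesis
        using g h by (auto simp: inj_on_def bij_betw_def) metis+
    qed
    show "?f ` ({..<m} <+> {..<m}) \<subseteq> verts (mono_graph S c k)"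
      using g h A B by (auto simp: bij_betw_def is_clique_def mono_graph_def)
    show "?f ` e \<in> edges (mono_graph S c k)"
      if "e \<in> image Inl ` [{..<m}]\<^bsup>2\<^esup> \<union> image Inr ` [{..<m}]\<^bsup>2\<^esup>" for e
      using that *[OF g A] *[OF h B] by (auto simp: image_image)
  qed
  then show ?thesis
    by (auto simp: contains_copy_iff_embeds)
qed

lemma copy_two_complete_graphsE:
  assumes "contains_copy (mono_graph S c k) (two_complete_graphs m)"
  obtains A B where "is_clique S c k m A" "is_clique S c k m B" "A \<inter> B = {}"
proof -
  obtain f where f: "embeds f (two_complete_graphs m) (mono_graph S c k)"
    using assms by (auto simp: contains_copy_iff_embeds)
  have inj: "inj_on f ({..<m} <+> {..<m})" and sub: "f ` ({..<m} <+> {..<m}) \<subseteq> S"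
    using f by (auto simp: embeds_def two_complete_graphs_simps mono_graph_def)
  have E: "c (f ` \<iota> ` e) = k" if "e \<in> [{..<m}]\<^bsup>2\<^esup>" "\<iota> = Inl \<or> \<iota> = Inr" for \<iota> e
    using f that by (auto simp: embeds_def two_complete_graphs_simps mono_graph_def)
  have cl: "is_clique S c k m ((\<lambda>i. f (\<iota> i)) ` {..<m})" if io: "\<iota> = Inl \<or> \<iota> = Inr" for \<iota>
  proof -
    have "inj_on (\<lambda>i. f (\<iota> i)) {..<m}"
      using inj io by (auto simp: inj_on_def)
    moreover have "c {f (\<iota> i), f (\<iota> j)} = k" if "i < m" "j < m" "f (\<iota> i) \<noteq> f (\<iota> j)" for i j
      using E[of "{i, j}" \<iota>] that io by auto
    ultimately show ?thesis
      using sub io by (auto simp: is_clique_def card_image)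
  qed
  have "(\<lambda>i. f (Inl i)) ` {..<m} \<inter> (\<lambda>i. f (Inr i)) ` {..<m} = {}"
    using inj by (auto simp: inj_on_def)
  then show ?thesis
    using that cl[of Inl] cl[of Inr] by blast
qed

lemma copy_two_complete_graphs_Suc:
  assumes "is_clique S c k m A" "is_clique S c k m B" "A \<inter> B = {}"
    and "x \<in> S" "y \<in> S" "x \<noteq> y" "{x, y} \<inter> (A \<union> B) = {}"
    and "\<And>z. z \<in> A \<Longrightarrow> c {x, z} = k" "\<And>z. z \<in> B \<Longrightarrow> c {y, z} = k"
  shows "contains_copy (mono_graph S c k) (two_complete_graphs (Suc m))"
  using assms
  by (intro copy_two_complete_graphsI[of S c k "Suc m" "insert x A" "insert y B"] is_clique_insert)
    auto

section \<open>Exchanging leaves of a red tree\<close>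

text \<open>
  The exchange argument, with \<open>M\<close> for \<open>(n - 1) * (m - 2) + 2\<close> and \<open>m\<close> for \<open>m - 1\<close>.  The size of \<open>S\<close> is
  chosen so that at least \<open>M\<close> vertices remain outside any red copy of \<open>T\<close>.
\<close>

lemma pendant_copy_or_two_cliques:
  fixes c :: "'b set \<Rightarrow> colour"
  assumes T: "is_tree T" and a: "is_leaf T a" and v: "v \<notin> verts T"
    and arr: "arrows M (add_pendant T a v) (two_complete_graphs m)"
    and S: "finite S" "M + card (verts T) \<le> card S"
    and f: "embeds f T (mono_graph S c Red)"
    and no_red: "\<not> contains_copy (mono_graph S c Red) (add_pendant T a v)"
  shows "contains_copy (mono_graph S c Blue) (two_complete_graphs (Suc m))"
proof (rule ccontr)
  assume no_blue: "\<not> ?thesis"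
  have G: "is_graph T"
    using T by (simp add: is_tree_def)
  have finT: "finite (verts T)"
    using G by (simp add: is_graph_def)
  have v_edge: "v \<notin> e" if "e \<in> edges T" for e
    using that G v by (auto simp: is_graph_def nsets_def)
  obtain p where p: "a \<in> verts T" "p \<in> verts T" "p \<noteq> a" "{a, p} \<in> edges T"
    "\<And>e. e \<in> edges T \<Longrightarrow> a \<in> e \<Longrightarrow> e = {a, p}"
    using is_leafE[OF G a] by metis
  have not_red: "c e \<noteq> Red \<longleftrightarrow> c e = Blue" for e
    by (cases "c e") auto
  have red_edge: "{y, z} \<in> edges (mono_graph S c Red)" if "y \<in> S" "z \<in> S" "y \<noteq> z" "c {y, z} = Red" for y z
    using that by (simp add: mono_graph_def)
  have in_S: "g z \<in> S" if "embeds g T (mono_graph S c Red)" "z \<in> verts T" for g z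
    using that by (auto simp: embeds_def mono_graph_def)

  \<comment> \<open>Stated for all copies \<open>g\<close>, since it is needed again for the copies that arise from \<open>f\<close> by exchanges.\<close>
  have blue_end: "c {g a, w} = Blue"
    if g: "embeds g T (mono_graph S c Red)" and w: "w \<in> S" "w \<notin> g ` verts T" for g w
  proof (rule ccontr)
    assume "c {g a, w} \<noteq> Blue"
    then have "{g a, w} \<in> edges (mono_graph S c Red)"
      using w in_S[OF g p(1)] p(1) by (intro red_edge) (auto simp: not_red[symmetric])
    then have "embeds (g(v := w)) (add_pendant T a v) (mono_graph S c Red)"
      using g p(1) v v_edge w
      by (intro embeds_fun_upd[of g T _ a]) (auto simp: add_pendant_def mono_graph_def insert_commute)
    then show False
      using no_red by (auto simp: contains_copy_iff_embeds)
  qed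
  have swap: "embeds (g(l := w)) T (mono_graph S c Red)"
    if g: "embeds g T (mono_graph S c Red)" and q: "q \<in> verts T" "q \<noteq> l" "l \<in> verts T"
      "\<And>e. e \<in> edges T \<Longrightarrow> l \<in> e \<Longrightarrow> e = {l, q}"
      and w: "w \<in> S" "w \<notin> g ` verts T" "c {g q, w} = Red" for g l q w
  proof -
    have "{g q, w} \<in> edges (mono_graph S c Red)"
      using w in_S[OF g q(1)] q(1) by (intro red_edge) auto
    then show ?thesis
      using g q w by (intro embeds_fun_upd[of g T _ q]) (auto simp: mono_graph_def)
  qed

  define W where "W = S - f ` verts T"
  have inj: "inj_on f (verts T)" and sub: "f ` verts T \<subseteq> S"
    using f by (auto simp: embeds_def mono_graph_def)
  have cardW: "M \<le> card W" and finW: "finite W"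
    using S sub inj finT by (auto simp: W_def card_Diff_subset card_image)
  have blue_pair: "\<exists>A B. is_clique S c Blue m A \<and> is_clique S c Blue m B \<and> A \<inter> B = {} \<and> A \<union> B \<subseteq> U"
    if U: "U \<subseteq> S" "M \<le> card U" for U
  proof -
    have "finite U"
      using U S finite_subset by blast
    then have "contains_copy (mono_graph U c Blue) (two_complete_graphs m)"
      using arrows_finite_set[OF arr, of U c] U(2) no_red mono_graph_copy_subset[OF _ U(1)] by blast
    then obtain A B where "is_clique U c Blue m A" "is_clique U c Blue m B" "A \<inter> B = {}"
      by (rule copy_two_complete_graphsE)
    then show ?thesis
      using U(1) by (intro exI[of _ A] exI[of _ B]) (auto simp: is_clique_def)
  qed
  obtain A B where AB: "is_clique S c Blue m A" "is_clique S c Blue m B" "A \<inter> B = {}" "A \<union> B \<subseteq> W"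
    using blue_pair[of W] cardW by (auto simp: W_def)
  define x where "x = f a"
  have xS: "x \<in> S" and xW: "x \<notin> W"
    using p(1) sub by (auto simp: x_def W_def)
  have x_blue: "c {x, w} = Blue" if "w \<in> W" for w
    using blue_end[OF f] that by (auto simp: x_def W_def)
  have red_nbr: "\<exists>w\<in>C. c {f z, w} = Red"
    if C: "C = A \<or> C = B" and z: "z \<in> verts T" "z \<noteq> a" for C z
  proof (rule ccontr)
    assume "\<not> ?thesis"
    then have zC: "\<And>w. w \<in> C \<Longrightarrow> c {f z, w} = Blue"
      using not_red by blast
    have fz: "f z \<in> S" "f z \<notin> W" "f z \<noteq> x"
      using z p(1) inj sub by (auto simp: x_def W_def inj_on_def)
    obtain D where D: "is_clique S c Blue m D" "is_clique S c Blue m C" "D \<inter> C = {}" "D \<union> C \<subseteq> W"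
      using AB C by (metis inf_commute sup_commute)
    have "contains_copy (mono_graph S c Blue) (two_complete_graphs (Suc m))"
      using D fz xS xW x_blue zC by (intro copy_two_complete_graphs_Suc[of S c Blue m D C x "f z"]) auto
    with no_blue show False ..
  qed
  show False
  proof (cases "card (verts T) \<le> 2")
    case True
    have "card {a, p} = 2"
      using p(3) by simp
    then have V: "verts T = {a, p}"
      using True p(1,2) finT card_seteq[of "verts T" "{a, p}"] by auto
    have edge: "e = {a, p}" if "e \<in> edges T" for e
    proof -
      have "e \<in> [{a, p}]\<^bsup>2\<^esup>"
        using that G V by (auto simp: is_graph_def)
      then show ?thesis
        by (auto simp: nsets_2_eq)
    qed
    \<comment> \<open>\<open>T\<close> is a single edge, so \<open>p\<close> can play the part of \<open>a\<close>; but its image has a red neighbour in \<open>A\<close>.\<close>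
    let ?g = "f(a := f p, p := f a)"
    have img: "?g ` verts T = f ` verts T"
      using V p(3) by auto
    have "embeds ?g T (mono_graph S c Red)"
      unfolding embeds_def
    proof (intro conjI ballI)
      show "inj_on ?g (verts T)"
        using inj V p(3) by (auto simp: inj_on_def)
      show "?g ` verts T \<subseteq> verts (mono_graph S c Red)"
        using img sub by (simp add: mono_graph_def)
      show "?g ` e \<in> edges (mono_graph S c Red)" if "e \<in> edges T" for e
      proof -
        have "?g ` e = f ` e"
          using edge[OF that] p(3) by auto
        then show ?thesis
          using f that by (simp add: embeds_def)
      qed
    qed
    moreover obtain w where "w \<in> A" "c {f p, w} = Red"
      using red_nbr[of A p] p by auto
    moreover have "w \<in> S" "w \<notin> ?g ` verts T"
      using \<open>w \<in> A\<close> AB(4) img by (auto simp: W_def)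
    ultimately show False
      using blue_end[of ?g w] p(3) by auto
  next
    case False
    then have "3 \<le> card (verts T)"
      by simp
    then obtain l q where lq: "l \<in> verts T" "q \<in> verts T" "l \<noteq> a" "q \<noteq> a" "q \<noteq> l"
      "\<And>e. e \<in> edges T \<Longrightarrow> l \<in> e \<Longrightarrow> e = {l, q}"
      using tree_second_leaf[OF T a] by metis
    \<comment> \<open>Taking \<open>w\<close> in \<open>A\<close> and \<open>u\<close> in \<open>B\<close> makes them distinct, so both exchanges can be done together.\<close>
    obtain w where w: "w \<in> A" "c {f p, w} = Red"
      using red_nbr[of A p] p by auto
    obtain u where u: "u \<in> B" "c {f q, u} = Red"
      using red_nbr[of B q] lq by auto
    have wS: "w \<in> S" "w \<in> W" "w \<notin> f ` verts T" and uS: "u \<in> S" "u \<notin> f ` verts T" "u \<noteq> w"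
      using w u AB by (auto simp: W_def)
    define g where "g = f(a := w)"
    have g: "embeds g T (mono_graph S c Red)"
      unfolding g_def using swap[OF f, of p a w] p w wS by blast
    have g_img: "g ` verts T = insert w (f ` (verts T - {a}))"
      using p(1) by (auto simp: g_def)
    have w_blue: "c {w, y} = Blue" if "y \<in> W \<union> {x}" "y \<noteq> w" for y
    proof -
      have "y \<in> S" "y \<notin> f ` (verts T - {a})"
        using that xS inj p(1) by (auto simp: W_def x_def inj_on_def)
      then show ?thesis
        using blue_end[OF g, of y] that(2) g_img by (auto simp: g_def)
    qed
    have fl: "f l \<in> S" "f l \<notin> W" "f l \<noteq> x" "f l \<noteq> w"
      using lq(1,3) p(1) inj sub wS by (auto simp: x_def W_def inj_on_def)
    have "embeds (f(l := u)) T (mono_graph S c Red)"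
      using swap[OF f, of q l u] lq u uS by blast
    moreover have "f l \<notin> (f(l := u)) ` verts T"
      using inj lq(1) uS by (auto simp: inj_on_def)
    ultimately have x_l: "c {x, f l} = Blue"
      using blue_end[of "f(l := u)" "f l"] fl lq(3) by (auto simp: x_def)
    have "embeds (g(l := u)) T (mono_graph S c Red)"
      using swap[OF g, of q l u] lq u uS g_img by (auto simp: g_def)
    moreover have "f l \<notin> (g(l := u)) ` verts T"
      using inj lq(1) uS fl(4) by (auto simp: inj_on_def g_def)
    ultimately have w_l: "c {w, f l} = Blue"
      using blue_end[of "g(l := u)" "f l"] fl lq(3) by (auto simp: g_def)
    \<comment> \<open>The image of \<open>l\<close> makes up for the loss of \<open>w\<close>, so the set is still large enough.\<close>
    let ?U = "insert (f l) (W - {w})"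
    have "card ?U = card W"
      using fl(2) finW wS(2) card_Suc_Diff1[of W w] by simp
    moreover have "?U \<subseteq> S"
      using fl(1) by (auto simp: W_def)
    ultimately obtain A' B' where AB': "is_clique S c Blue m A'" "is_clique S c Blue m B'" "A' \<inter> B' = {}"
      "A' \<union> B' \<subseteq> ?U"
      using blue_pair[of ?U] cardW by metis
    have "contains_copy (mono_graph S c Blue) (two_complete_graphs (Suc m))"
    proof (rule copy_two_complete_graphs_Suc[OF AB'(1-3), of x w])
      show "c {x, z} = Blue" if "z \<in> A'" for z
        using that AB'(4) x_blue x_l by auto
      show "c {w, z} = Blue" if "z \<in> B'" for z
        using that AB'(4) w_blue w_l by auto
    qed (use xS xW wS fl AB'(4) in auto)
    with no_blue show False ..
  qed
qed

theorem lemma2p1: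
  fixes n m :: nat and T_star T_star2 :: "'a graph" and a :: 'a
  assumes "n \<ge> 3" and "m \<ge> 2"
    and "\<forall>T :: 'a graph. is_tree T \<and> card (verts T) = n \<longrightarrow>
           ramsey_number T (two_complete_graphs (m - 1)) \<le> (n - 1) * (m - 2) + 2"
    and "is_tree T_star" and "card (verts T_star) = n"
    and "is_leaf T_star a" and "stretching T_star a T_star2"
    and "ramsey_number T_star (two_complete_graphs m) \<le> (n - 1) * (m - 1) + 2"
  shows "ramsey_number T_star2 (two_complete_graphs m) \<le> (n - 1) * (m - 1) + 2"
proof -
  obtain b v where b: "is_leaf T_star b" "b \<noteq> a" and v: "v \<notin> verts T_star"
    and T2: "T_star2 = Graph (insert v (verts T_star - {b})) (insert {a, v} {e \<in> edges T_star. b \<notin> e})"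
    using assms(7) by (auto simp: stretching_def)
  define D where "D = delete_vertex T_star b"
  have T2': "T_star2 = add_pendant D a v"
    by (simp add: T2 D_def add_pendant_def delete_vertex_def)
  have G: "is_graph T_star" and fin: "finite (verts T_star)"
    using assms(4) by (auto simp: is_tree_def is_graph_def)
  have D: "is_tree D"
    unfolding D_def using assms(4) b(1) by (rule is_tree_delete_leaf)
  have vD: "v \<notin> verts D"
    using v by (simp add: D_def delete_vertex_def)
  have bV: "b \<in> verts T_star"
    using b by (simp add: is_leaf_def)
  have cardD: "card (verts D) = n - 1" and finD: "finite (verts D)"
    using bV fin assms(5) by (auto simp: D_def delete_vertex_def)
  obtain p where p: "a \<in> verts T_star" "p \<in> verts T_star" "p \<noteq> a" "{a, p} \<in> edges T_star"
    "\<And>e. e \<in> edges T_star \<Longrightarrow> a \<in> e \<Longrightarrow> e = {a, p}"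
    using is_leafE[OF G assms(6)] by metis
  have "p \<noteq> b"
  proof
    \<comment> \<open>Two adjacent leaves would form a component of their own.\<close>
    assume "p = b"
    obtain r where r: "r \<notin> {a, p}" "{p, r} \<in> edges T_star"
      using connected_leaf_neighbour_branches[OF G _ _ p(1-3,5)] assms(1,4,5)
      unfolding is_tree_def by blast
    obtain c where c: "\<And>e. e \<in> edges T_star \<Longrightarrow> b \<in> e \<Longrightarrow> e = {b, c}"
      using is_leafE[OF G b(1)] by metis
    have "{a, b} = {b, c}" "{b, r} = {b, c}"
      using c[of "{a, b}"] c[of "{b, r}"] p(4) r(2) \<open>p = b\<close> by auto
    then show False
      using r(1) b(2) by (auto simp: doubleton_eq_iff)
  qed
  then have aD: "is_leaf D a"
    using p(1,4) b(2) by (intro is_leafI[of _ _ p]) (auto simp: D_def delete_vertex_def dest: p(5))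
  then have aVD: "a \<in> verts D"
    by (simp add: is_leaf_def)
  have tree2: "is_tree T_star2"
    unfolding T2' using D aVD vD by (rule is_tree_add_pendant)
  have "card (verts T_star2) = n"
    using cardD finD vD assms(1) by (simp add: T2' add_pendant_def)
  then have arr2: "arrows ((n - 1) * (m - 2) + 2) T_star2 (two_complete_graphs (m - 1))"
    using assms(3) tree2 by (simp add: arrows_iff_ramsey_number_le is_tree_def is_graph_two_complete_graphs)
  have arr1: "arrows ((n - 1) * (m - 1) + 2) T_star (two_complete_graphs m)"
    using assms(8) G by (simp add: arrows_iff_ramsey_number_le is_graph_two_complete_graphs)
  have m: "m = Suc (m - 1)" "m - 1 = Suc (m - 2)"
    using assms(2) by auto
  have size: "(n - 1) * (m - 2) + 2 + card (verts D) = (n - 1) * (m - 1) + 2"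
    unfolding m(2) cardD by simp
  have "arrows ((n - 1) * (m - 1) + 2) T_star2 (two_complete_graphs m)"
    unfolding arrows_def colour_graph_complete_graph
  proof (intro allI disjCI)
    let ?S = "{..<(n - 1) * (m - 1) + 2}"
    fix c assume no_blue: "\<not> contains_copy (mono_graph ?S c Blue) (two_complete_graphs m)"
    show "contains_copy (mono_graph ?S c Red) T_star2"
    proof (rule ccontr)
      assume no_red: "\<not> ?thesis"
      obtain f where "embeds f T_star (mono_graph ?S c Red)"
        using arr1 no_blue unfolding arrows_def colour_graph_complete_graph contains_copy_iff_embeds
        by blast
      then have f: "embeds f D (mono_graph ?S c Red)"
        by (auto simp: embeds_def D_def delete_vertex_def intro: inj_on_subset)
      have "contains_copy (mono_graph ?S c Blue) (two_complete_graphs (Suc (m - 1)))"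
        using pendant_copy_or_two_cliques[OF D aD vD arr2[unfolded T2'], of ?S f c] f no_red size
        by (simp add: T2')
      then show False
        using no_blue m(1) by simp
    qed
  qed
  then show ?thesis
    using tree2 by (simp add: arrows_iff_ramsey_number_le is_tree_def is_graph_two_complete_graphs)
qed

end
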